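(* Let $n\ge 0$ be an integer. The matchings of $[2n]$ with no left-crossing are in bijection with the inversion tables of length $n$; hence there are exactly $n!$ such matchings.
   Context: $[m]=\{1,\dots,m\}$. A matching of $[2n]$ is a partition of $[2n]$ into blocks of size $2$; the blocks are called arcs and written $(i,j)$ with $i<j$. A crossing of a matching $M$ is a pair of arcs $(i,k)$ and $(j,\ell)$ of $M$ with $i<j<k<\ell$; it is a left-crossing if $j=i+1$. An inversion table of length $n$ is an integer sequence $(a_1,\dots,a_n)$ with $0\le a_i\le i-1$ for all $i$. *)

theory Defs
  imports Main "HOL-Library.Disjoint_Sets"
begin

definition matching :: "nat \<Rightarrow> nat set set \<Rightarrow> bool" where
  "matching m M \<longleftrightarrow> partition_on {1..m} M \<and> (\<forall>B\<in>M. card B = 2)"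

definition arcs :: "nat set set \<Rightarrow> (nat \<times> nat) set" where
  "arcs M = {(i, j). i < j \<and> {i, j} \<in> M}"

definition crossing :: "nat set set \<Rightarrow> nat \<times> nat \<Rightarrow> nat \<times> nat \<Rightarrow> bool" where
  "crossing M a b \<longleftrightarrow> a \<in> arcs M \<and> b \<in> arcs M \<and>
     fst a < fst b \<and> fst b < snd a \<and> snd a < snd b"

definition left_crossing :: "nat set set \<Rightarrow> nat \<times> nat \<Rightarrow> nat \<times> nat \<Rightarrow> bool" where
  "left_crossing M a b \<longleftrightarrow> crossing M a b \<and> fst b = fst a + 1"

definition no_left_crossing_matchings :: "nat \<Rightarrow> nat set set set" where
  "no_left_crossing_matchings n =
     {M. matching (2 * n) M \<and> (\<nexists>a b. left_crossing M a b)}"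

text \<open>The 1-based entry $a_i$ is the list element at position \<open>i - 1\<close>.\<close>

definition inversion_tables :: "nat \<Rightarrow> int list set" where
  "inversion_tables n =
     {a. length a = n \<and> (\<forall>i\<in>{1..n}. 0 \<le> a ! (i - 1) \<and> a ! (i - 1) \<le> int i - 1)}"

end

theory Submission
  imports Defs
begin

text \<open>
  Every matching of \<open>[m + 2]\<close> arises from exactly one matching of \<open>[m]\<close> and one \<open>i \<in> [m + 1]\<close>:
  make room for a new point at position \<open>i\<close> and join it to a new last point \<open>m + 2\<close>
  (\<open>bij_betw_insert_arc\<close>).

  Call the left endpoint of an arc an opener and the right endpoint a closer.
  The new arc has the largest right endpoint.  Hence, if the new opener \<open>i\<close> stands immediately to
  the right of an opener, the two arcs form a left-crossing; if it stands immediately to the left of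
  an opener, the two arcs are nested.  Moreover, when \<open>i\<close> is put between two points that formed a
  left-crossing, its left neighbour is an opener, so a left-crossing survives.  Therefore the larger
  matching has no left-crossing iff the smaller one has none and \<open>i\<close> is either the first point or
  immediately follows a closer (\<open>no_left_crossing_insert_arc_iff\<close>).  A matching of \<open>[2n]\<close> has \<open>n\<close>
  closers and thus admits \<open>n + 1\<close> such positions, whatever the matching is.  So the number of
  matchings without left-crossing is multiplied by \<open>n + 1\<close> when passing from \<open>n\<close> to \<open>n + 1\<close>.  The
  number of inversion tables grows by the same factor, because a table is extended by an arbitrary
  last entry from \<open>{0..n}\<close>; the bijection is then obtained by comparing cardinalities.
\<close>

section \<open>Arcs of a matching\<close>

lemma matching_blockE:
  assumes "matching m M" "B \<in> M"
  obtains a b where "B = {a, b}" "1 \<le> a" "a < b" "b \<le> m" "(a, b) \<in> arcs M"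
proof -
  from assms obtain x y where xy: "B = {x, y}" "x \<noteq> y"
    by (auto simp: matching_def card_2_iff)
  from assms have "B \<subseteq> {1..m}" by (auto simp: matching_def partition_on_def)
  then show ?thesis
    using that[of x y] that[of y x] xy assms(2) by (cases "x < y") (auto simp: arcs_def insert_commute)
qed

lemma matching_block_unique:
  assumes "matching m M" "B \<in> M" "C \<in> M" "x \<in> B" "x \<in> C"
  shows "B = C"
  using assms by (auto simp: matching_def partition_on_def disjoint_def)

lemma arcs_bounds:
  assumes "matching m M" "(a, b) \<in> arcs M"
  shows "1 \<le> a" "a < b" "b \<le> m"
  using assms by (auto simp: arcs_def matching_def partition_on_def)

lemma arcs_not_opener_and_closer:
  assumes "matching m M" "(a, b) \<in> arcs M"
  shows "(b, c) \<notin> arcs M"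
proof
  assume "(b, c) \<in> arcs M"
  with assms have *: "{a, b} \<in> M" "{b, c} \<in> M" "a < b" "b < c" by (auto simp: arcs_def)
  then have "{a, b} = {b, c}"
    by (intro matching_block_unique[OF assms(1), of _ _ b]) auto
  then show False using * by (auto simp: doubleton_eq_iff)
qed

lemma point_in_arc:
  assumes "matching m M" "1 \<le> x" "x \<le> m"
  obtains y where "(x, y) \<in> arcs M" | y where "(y, x) \<in> arcs M"
proof -
  from assms obtain B where "B \<in> M" "x \<in> B"
    by (metis UnionE atLeastAtMost_iff matching_def partition_on_def)
  with assms(1) show ?thesis using that by (elim matching_blockE) auto
qed

definition closers :: "nat set set \<Rightarrow> nat set" where
  "closers M = snd ` arcs M"

text \<open>Every block has exactly one closer, its maximum, and there are half as many blocks as points.\<close>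

lemma card_closers:
  assumes "matching (2 * n) M"
  shows "card (closers M) = n"
proof -
  have Max_pair: "Max {a, b} = b" if "a < b" for a b :: nat
    using that by simp
  have "closers M = Max ` M"
  proof (rule set_eqI)
    fix x
    show "x \<in> closers M \<longleftrightarrow> x \<in> Max ` M"
    proof
      assume "x \<in> closers M"
      then obtain a where "a < x" "{a, x} \<in> M" by (auto simp: closers_def arcs_def)
      then show "x \<in> Max ` M" using Max_pair by (metis image_eqI)
    next
      assume "x \<in> Max ` M"
      then obtain B where B: "B \<in> M" "x = Max B" by auto
      from assms B(1) obtain a b where "B = {a, b}" "a < b" "(a, b) \<in> arcs M"
        by (elim matching_blockE)
      then show "x \<in> closers M" using B(2) by (force simp: closers_def)
    qed
  qed
  moreover have "inj_on Max M"
  proof (rule inj_onI)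
    fix B C assume BC: "B \<in> M" "C \<in> M" "Max B = Max C"
    have "finite D \<and> D \<noteq> {}" if "D \<in> M" for D
      using assms that by (elim matching_blockE) auto
    with BC have "finite B" "B \<noteq> {}" "finite C" "C \<noteq> {}" by auto
    then show "B = C"
      using matching_block_unique[OF assms BC(1,2), of "Max B"] BC(3) Max_in[of B] Max_in[of C] by simp
  qed
  moreover have "2 * card M = card (\<Union>M)"
  proof (rule card_partition)
    have "\<Union>M = {1..2 * n}" using assms by (simp add: matching_def partition_on_def)
    then show "finite (\<Union>M)" by simp
    then show "finite M" by (rule finite_UnionD)
  qed (use assms in \<open>auto simp: matching_def partition_on_def disjoint_def\<close>)
  moreover have "card (\<Union>M) = 2 * n"
    using assms by (simp add: matching_def partition_on_def)
  ultimately show ?thesis by (simp add: card_image)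
qed

lemma no_left_crossing_iff_arcs:
  "(\<nexists>a b. left_crossing M a b) \<longleftrightarrow>
     (\<forall>a c d. (a, c) \<in> arcs M \<longrightarrow> (Suc a, d) \<in> arcs M \<longrightarrow> Suc a < c \<longrightarrow> \<not> c < d)"
  by (auto simp: left_crossing_def crossing_def)

section \<open>Inserting an arc that ends at a new last point\<close>

text \<open>The increasing bijection from the naturals onto the naturals without \<open>i\<close>.\<close>

definition skip :: "nat \<Rightarrow> nat \<Rightarrow> nat" where
  "skip i x = (if x < i then x else Suc x)"

lemma strict_mono_skip: "strict_mono (skip i)"
  by (auto simp: strict_mono_def skip_def)

lemma inj_skip: "inj (skip i)"
  by (rule strict_mono_imp_inj_on[OF strict_mono_skip])

lemma skip_neq [simp]: "skip i x \<noteq> i" "i \<noteq> skip i x"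
  by (auto simp: skip_def)

lemma skip_image_neq: "skip i ` B \<noteq> insert i C"
proof
  assume "skip i ` B = insert i C"
  then have "i \<in> skip i ` B" by simp
  then show False by auto
qed

lemma range_skip: "range (skip i) = - {i}"
proof -
  have "x \<in> range (skip i)" if "x \<noteq> i" for x
    using that by (intro image_eqI[of _ _ "if x < i then x else x - 1"]) (auto simp: skip_def)
  then show ?thesis by auto
qed

lemma skip_bounds:
  assumes "1 \<le> i" "i \<le> m + 1"
  shows "1 \<le> skip i x \<and> skip i x \<le> m + 1 \<longleftrightarrow> 1 \<le> x \<and> x \<le> m"
  using assms by (auto simp: skip_def)

definition insert_arc :: "nat \<Rightarrow> nat \<Rightarrow> nat set set \<Rightarrow> nat set set" where
  "insert_arc m i M = insert {i, m + 2} ((`) (skip i) ` M)"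

lemma arcs_image:
  assumes "strict_mono (f :: nat \<Rightarrow> nat)"
  shows "arcs ((`) f ` M) = map_prod f f ` arcs M"
proof (rule set_eqI, clarify)
  fix a b
  have inj: "inj f" using assms by (rule strict_mono_imp_inj_on)
  show "(a, b) \<in> arcs ((`) f ` M) \<longleftrightarrow> (a, b) \<in> map_prod f f ` arcs M"
  proof
    assume "(a, b) \<in> arcs ((`) f ` M)"
    then obtain B where B: "B \<in> M" "f ` B = {a, b}" "a < b" by (auto simp: arcs_def)
    then obtain x y where xy: "x \<in> B" "y \<in> B" "a = f x" "b = f y"
      by (metis (no_types, lifting) imageE insertI1 insertI2)
    then have "f ` B = f ` {x, y}" using B by simp
    then have "B = {x, y}" by (simp only: inj_image_eq_iff[OF inj])
    moreover have "x < y" using B(3) xy(3,4) by (simp add: strict_mono_less[OF assms])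
    ultimately have "(x, y) \<in> arcs M" using B(1) by (simp add: arcs_def)
    then show "(a, b) \<in> map_prod f f ` arcs M" using xy(3,4) by (simp add: rev_image_eqI)
  next
    assume "(a, b) \<in> map_prod f f ` arcs M"
    then obtain x y where xy: "(x, y) \<in> arcs M" "a = f x" "b = f y" by auto
    then have "{a, b} = f ` {x, y}" "{x, y} \<in> M" "a < b"
      by (simp_all add: arcs_def strict_mono_less[OF assms])
    then show "(a, b) \<in> arcs ((`) f ` M)" unfolding arcs_def by blast
  qed
qed

lemma arcs_insert_arc:
  assumes "i \<le> m + 1"
  shows "arcs (insert_arc m i M) = insert (i, m + 2) (map_prod (skip i) (skip i) ` arcs M)"
proof -
  have "arcs (insert_arc m i M) = insert (i, m + 2) (arcs ((`) (skip i) ` M))"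
    using assms by (auto simp: arcs_def insert_arc_def doubleton_eq_iff)
  then show ?thesis by (simp add: arcs_image strict_mono_skip)
qed

lemma matching_insert_arc:
  assumes M: "matching m M" and i: "1 \<le> i" "i \<le> m + 1"
  shows "matching (m + 2) (insert_arc m i M)"
proof -
  have P: "partition_on {1..m} M" and c: "\<And>B. B \<in> M \<Longrightarrow> card B = 2"
    using M by (auto simp: matching_def)
  have "skip i ` {1..m} = {1..m + 1} - {i}"
  proof (rule set_eqI)
    fix y
    show "y \<in> skip i ` {1..m} \<longleftrightarrow> y \<in> {1..m + 1} - {i}"
    proof
      assume y: "y \<in> {1..m + 1} - {i}"
      then obtain x where x: "y = skip i x" using range_skip[of i] by blast
      then have "x \<in> {1..m}" using y skip_bounds[OF i, of x] by simp
      then show "y \<in> skip i ` {1..m}" using x by blast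
    next
      assume "y \<in> skip i ` {1..m}"
      then obtain x where "y = skip i x" "x \<in> {1..m}" by blast
      then show "y \<in> {1..m + 1} - {i}" using skip_bounds[OF i, of x] by simp
    qed
  qed
  moreover have "{} \<notin> (`) (skip i) ` M"
    using partition_onD3[OF P] by auto
  ultimately have *: "partition_on ({1..m + 1} - {i}) ((`) (skip i) ` M)"
    using partition_on_inj_image[OF P inj_on_subset[OF inj_skip[of i] subset_UNIV]] by simp
  then have "\<Union> ((`) (skip i) ` M) = {1..m + 1} - {i}"
    by (simp only: partition_on_def)
  then have dj: "disjnt {i, m + 2} (\<Union> ((`) (skip i) ` M))"
    by (simp only: disjnt_def) auto
  have "{1..m + 2} - {i, m + 2} = {1..m + 1} - {i}" by auto
  then have "partition_on {1..m + 2} (insert_arc m i M)"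
    unfolding insert_arc_def partition_on_insert[OF dj] using * i by simp
  moreover have "card B = 2" if "B \<in> insert_arc m i M" for B
    using that c i by (auto simp: insert_arc_def card_image inj_on_subset[OF inj_skip])
  ultimately show ?thesis by (simp add: matching_def)
qed

text \<open>The blocks of the smaller matching can be read off from the larger one as preimages, because
  the new arc contains the skipped point \<open>i\<close>.\<close>

lemma skip_image_in_insert_arc_iff: "skip i ` B \<in> insert_arc m i M \<longleftrightarrow> B \<in> M"
  by (auto simp: insert_arc_def inj_image_eq_iff[OF inj_skip] skip_image_neq)

text \<open>The partner of the last point can only be its opener, which gives \<open>i\<close>; all other blocks
  avoid \<open>i\<close> and the last point and can be shifted back.\<close>

lemma insert_arc_surj:
  assumes N: "matching (m + 2) N"
  obtains i M where "1 \<le> i" "i \<le> m + 1" "matching m M" "N = insert_arc m i M"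
proof -
  have "(m + 2, y) \<notin> arcs N" for y
    using arcs_bounds[OF N, of "m + 2" y] by auto
  then obtain i where iN': "(i, m + 2) \<in> arcs N"
    using point_in_arc[OF N, of "m + 2"] by auto
  then have i: "1 \<le> i" "i \<le> m + 1" and iN: "{i, m + 2} \<in> N"
    using arcs_bounds[OF N iN'] by (auto simp: arcs_def)
  have U: "\<Union>N = {1..m + 2}" and dj: "disjoint N" and ne: "{} \<notin> N" and c: "\<And>B. B \<in> N \<Longrightarrow> card B = 2"
    using N by (auto simp: matching_def partition_on_def)
  define M where "M = {B. skip i ` B \<in> N}"
  have other: "B \<subseteq> {1..m + 1} - {i}" if "B \<in> N" "B \<noteq> {i, m + 2}" for B
  proof -
    have "i \<notin> B" "m + 2 \<notin> B" using matching_block_unique[OF N that(1) iN] that(2) by auto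
    moreover have "B \<subseteq> {1..m + 2}" using U that(1) by blast
    moreover have "{1..m + 2} - {i, m + 2} = {1..m + 1} - {i}" by auto
    ultimately show ?thesis by blast
  qed
  have pre: "\<exists>B\<in>M. skip i ` B = C" if "C \<in> N" "C \<noteq> {i, m + 2}" for C
  proof -
    have "C \<subseteq> range (skip i)" using other[OF that] range_skip[of i] by auto
    then obtain B where "C = skip i ` B" by (auto simp: subset_image_iff)
    then show ?thesis using that by (auto simp: M_def)
  qed
  have "N = insert_arc m i M"
  proof (intro equalityI subsetI)
    fix C assume "C \<in> N"
    then show "C \<in> insert_arc m i M" using pre unfolding insert_arc_def by blast
  next
    fix C assume "C \<in> insert_arc m i M"
    then show "C \<in> N" using iN by (auto simp: insert_arc_def M_def)
  qed
  moreover have "matching m M"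
    unfolding matching_def
  proof (intro conjI ballI partition_onI)
    show "\<Union>M = {1..m}"
    proof (intro equalityI subsetI)
      fix x assume "x \<in> \<Union>M"
      then obtain B where B: "x \<in> B" "skip i ` B \<in> N" by (auto simp: M_def)
      then have "skip i x \<in> {1..m + 1} - {i}" using other[OF _ skip_image_neq] by blast
      then show "x \<in> {1..m}" using skip_bounds[OF i, of x] by simp
    next
      fix x assume "x \<in> {1..m}"
      then have x: "1 \<le> skip i x" "skip i x \<le> m + 1" using skip_bounds[OF i, of x] by auto
      then have "skip i x \<in> \<Union>N" unfolding U by simp
      then obtain C where C: "C \<in> N" "skip i x \<in> C" by blast
      moreover have "C \<noteq> {i, m + 2}" using C x by auto
      ultimately obtain B where "B \<in> M" "skip i ` B = C" using pre by blast
      then show "x \<in> \<Union>M" using C(2) inj_image_mem_iff[OF inj_skip] by blast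
    qed
    show "disjnt p q" if "p \<in> M" "q \<in> M" "p \<noteq> q" for p q
    proof -
      have "skip i ` p \<noteq> skip i ` q" using that(3) by (simp add: inj_image_eq_iff[OF inj_skip])
      then have "skip i ` p \<inter> skip i ` q = {}" using that(1,2) dj by (simp add: M_def disjoint_def)
      then show ?thesis by (auto simp: disjnt_def)
    qed
    show "{} \<notin> M" using ne by (simp add: M_def)
    show "card B = 2" if "B \<in> M" for B
      using that c[of "skip i ` B"] by (simp add: M_def card_image inj_on_subset[OF inj_skip])
  qed
  ultimately show ?thesis using that i by blast
qed

text \<open>Injectivity: the block of the last point determines \<open>i\<close>, and then preimages under the shift
  determine \<open>M\<close>.\<close>

lemma bij_betw_insert_arc:
  "bij_betw (\<lambda>(M, i). insert_arc m i M)
     ({M. matching m M} \<times> {1..m + 1}) {N. matching (m + 2) N}"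
  unfolding bij_betw_def
proof (intro conjI inj_onI)
  fix p q
  assume "p \<in> {M. matching m M} \<times> {1..m + 1}" "q \<in> {M. matching m M} \<times> {1..m + 1}"
    and "(\<lambda>(M, i). insert_arc m i M) p = (\<lambda>(M, i). insert_arc m i M) q"
  then obtain M i M' i' where p: "p = (M, i)" "matching m M" "1 \<le> i" "i \<le> m + 1"
    and q: "q = (M', i')" and eq: "insert_arc m i M = insert_arc m i' M'"
    by auto
  have "{i, m + 2} \<in> insert_arc m i M" by (simp add: insert_arc_def)
  moreover have "{i', m + 2} \<in> insert_arc m i M" unfolding eq by (simp add: insert_arc_def)
  ultimately have "{i, m + 2} = {i', m + 2}"
    by (rule matching_block_unique[OF matching_insert_arc[OF p(2-4)], where x = "m + 2"]) auto
  then have "i = i'" by (auto simp: doubleton_eq_iff)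
  then have "M = M'"
    using eq skip_image_in_insert_arc_iff[of i _ m] by blast
  then show "p = q" using p q \<open>i = i'\<close> by simp
next
  show "(\<lambda>(M, i). insert_arc m i M) ` ({M. matching m M} \<times> {1..m + 1}) = {N. matching (m + 2) N}"
  proof (intro equalityI subsetI)
    fix N assume "N \<in> (\<lambda>(M, i). insert_arc m i M) ` ({M. matching m M} \<times> {1..m + 1})"
    then obtain M i where "N = insert_arc m i M" "matching m M" "1 \<le> i" "i \<le> m + 1" by auto
    then show "N \<in> {N. matching (m + 2) N}" using matching_insert_arc by blast
  next
    fix N assume "N \<in> {N. matching (m + 2) N}"
    then obtain i M where "1 \<le> i" "i \<le> m + 1" "matching m M" "N = insert_arc m i M"
      by (blast elim: insert_arc_surj)
    then show "N \<in> (\<lambda>(M, i). insert_arc m i M) ` ({M. matching m M} \<times> {1..m + 1})"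
      by (intro image_eqI[of _ _ "(M, i)"]) simp_all
  qed
qed

section \<open>Where the insertion creates no left-crossing\<close>

text \<open>Positions of a new opener as numbered after the insertion, hence the successor.\<close>

definition insertion_sites :: "nat set set \<Rightarrow> nat set" where
  "insertion_sites M = insert 1 (Suc ` closers M)"

lemma insertion_sites_subset:
  assumes "matching m M"
  shows "insertion_sites M \<subseteq> {1..m + 1}"
  using arcs_bounds[OF assms] by (auto simp: insertion_sites_def closers_def)

text \<open>In a matching, not being an opener is the same as being a closer or lying outside
  the ground set.\<close>

lemma insertion_sites_iff:
  assumes M: "matching m M" and i: "1 \<le> i" "i \<le> m + 1"
  shows "i \<in> insertion_sites M \<longleftrightarrow> (\<nexists>c. (i - 1, c) \<in> arcs M)"
proof (cases "i = 1")
  case True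
  then show ?thesis using arcs_bounds(1)[OF M] by (auto simp: insertion_sites_def)
next
  case False
  then obtain j where j: "i = Suc j" "1 \<le> j" "j \<le> m" using i by (cases i) auto
  have "j \<in> closers M \<longleftrightarrow> (\<exists>a. (a, j) \<in> arcs M)" by (force simp: closers_def)
  also have "\<dots> \<longleftrightarrow> (\<nexists>c. (j, c) \<in> arcs M)"
    using arcs_not_opener_and_closer[OF M] point_in_arc[OF M j(2,3)] by blast
  finally show ?thesis using False j(1) by (auto simp: insertion_sites_def)
qed

lemma card_insertion_sites:
  assumes "matching (2 * n) M"
  shows "card (insertion_sites M) = Suc n"
proof -
  have "1 \<notin> Suc ` closers M"
    using arcs_bounds[OF assms] by (fastforce simp: closers_def)
  moreover have "finite (closers M)"
    using arcs_bounds[OF assms] by (auto simp: closers_def intro!: finite_subset[of _ "{..2 * n}"])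
  ultimately show ?thesis
    by (simp add: insertion_sites_def card_image card_closers[OF assms])
qed

text \<open>Shifting preserves the adjacency of two openers unless the new opener \<open>i\<close> separates them, and
  then the left one of them forms a left-crossing with the new arc.  The new arc itself can only be
  the right-hand arc of a crossing, since it has the largest endpoint.\<close>

lemma no_left_crossing_insert_arc_iff:
  assumes M: "matching m M" and i: "1 \<le> i" "i \<le> m + 1"
  shows "(\<nexists>a b. left_crossing (insert_arc m i M) a b) \<longleftrightarrow>
           (\<nexists>a b. left_crossing M a b) \<and> i \<in> insertion_sites M"
proof -
  let ?N = "insert_arc m i M"
  note arcsN = arcs_insert_arc[OF i(2), of M]
  have lift: "(skip i a, skip i b) \<in> arcs ?N" if "(a, b) \<in> arcs M" for a b
    using that by (auto simp: arcsN intro!: image_eqI[of _ _ "(a, b)"])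
  have new: "(i, m + 2) \<in> arcs ?N" by (simp add: arcsN)
  show ?thesis
    unfolding no_left_crossing_iff_arcs
  proof (intro iffI conjI allI impI)
    assume N: "\<forall>a c d. (a, c) \<in> arcs ?N \<longrightarrow> (Suc a, d) \<in> arcs ?N \<longrightarrow> Suc a < c \<longrightarrow> \<not> c < d"
    show site: "i \<in> insertion_sites M"
      unfolding insertion_sites_iff[OF M i]
    proof
      assume "\<exists>c. (i - 1, c) \<in> arcs M"
      then obtain c where c: "(i - 1, c) \<in> arcs M" by blast
      have b: "1 \<le> i - 1" "i - 1 < c" "c \<le> m" using arcs_bounds[OF M c] by auto
      then have "skip i (i - 1) = i - 1" "skip i c = Suc c" by (auto simp: skip_def)
      then have "(i - 1, Suc c) \<in> arcs ?N" using lift[OF c] by simp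
      moreover have "Suc (i - 1) = i" "i < Suc c" "Suc c < m + 2" using b by linarith+
      ultimately show False using N new by metis
    qed
    fix a c d assume ac: "(a, c) \<in> arcs M" and ad: "(Suc a, d) \<in> arcs M" and "Suc a < c"
    have "Suc a \<noteq> i" using site ac by (auto simp: insertion_sites_iff[OF M i])
    then have "skip i (Suc a) = Suc (skip i a)" by (auto simp: skip_def)
    then show "\<not> c < d"
      using N lift[OF ac] lift[OF ad] \<open>Suc a < c\<close> strict_mono_less[OF strict_mono_skip] by metis
  next
    assume *: "(\<forall>a c d. (a, c) \<in> arcs M \<longrightarrow> (Suc a, d) \<in> arcs M \<longrightarrow> Suc a < c \<longrightarrow> \<not> c < d)
      \<and> i \<in> insertion_sites M"
    fix a c d assume ac: "(a, c) \<in> arcs ?N" and ad: "(Suc a, d) \<in> arcs ?N" and ineq: "Suc a < c"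
    show "\<not> c < d"
    proof
      assume "c < d"
      \<comment> \<open>The left arc ends before \<open>d\<close>, so it is not the new arc.\<close>
      have "d \<le> m + 2" using arcs_bounds[OF matching_insert_arc[OF M i] ad] by simp
      then obtain a' c' where ac': "(a', c') \<in> arcs M" "a = skip i a'" "c = skip i c'"
        using ac \<open>c < d\<close> by (auto simp: arcsN)
      show False
      proof (cases "Suc a = i")
        case True
        then have "a' = i - 1" using ac'(2) by (auto simp: skip_def split: if_splits)
        then show False using * ac'(1) by (auto simp: insertion_sites_iff[OF M i])
      next
        case False
        then obtain b' d' where bd': "(b', d') \<in> arcs M" "Suc a = skip i b'" "d = skip i d'"
          using ad by (auto simp: arcsN)
        have b': "b' = Suc a'" using ac'(2) bd'(2) by (auto simp: skip_def split: if_splits)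
        have "Suc a' < c'" "c' < d'"
          using ineq \<open>c < d\<close> ac'(3) bd'(2,3) b' strict_mono_less[OF strict_mono_skip] by metis+
        then show False using * ac'(1) bd'(1) b' by blast
      qed
    qed
  qed
qed

section \<open>Counting\<close>

lemma no_left_crossing_matchings_0: "no_left_crossing_matchings 0 = {{}}"
  by (auto simp: no_left_crossing_matchings_def matching_def partition_on_def
      left_crossing_def crossing_def arcs_def)

lemma bij_betw_insert_arc_no_left_crossing:
  "bij_betw (\<lambda>(M, i). insert_arc (2 * n) i M)
     (SIGMA M : no_left_crossing_matchings n. insertion_sites M)
     (no_left_crossing_matchings (Suc n))"
proof (rule bij_betw_subset[OF bij_betw_insert_arc])
  let ?ins = "\<lambda>(M, i). insert_arc (2 * n) i M"
  let ?S = "SIGMA M : no_left_crossing_matchings n. insertion_sites M"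
  show sub: "?S \<subseteq> {M. matching (2 * n) M} \<times> {1..2 * n + 1}"
    using insertion_sites_subset by (fastforce simp: no_left_crossing_matchings_def)
  show "?ins ` ?S = no_left_crossing_matchings (Suc n)"
  proof (intro equalityI subsetI)
    fix N assume "N \<in> ?ins ` ?S"
    then obtain M i where "N = insert_arc (2 * n) i M" "(M, i) \<in> ?S" by auto
    moreover from this have "matching (2 * n) M" "1 \<le> i" "i \<le> 2 * n + 1" using sub by auto
    ultimately show "N \<in> no_left_crossing_matchings (Suc n)"
      using matching_insert_arc[of "2 * n" M i] no_left_crossing_insert_arc_iff[of "2 * n" M i]
      by (simp add: no_left_crossing_matchings_def)
  next
    fix N assume "N \<in> no_left_crossing_matchings (Suc n)"
    then have N: "matching (2 * n + 2) N" "\<nexists>a b. left_crossing N a b"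
      by (simp_all add: no_left_crossing_matchings_def)
    from N(1) obtain i M where *: "1 \<le> i" "i \<le> 2 * n + 1" "matching (2 * n) M" "N = insert_arc (2 * n) i M"
      by (elim insert_arc_surj)
    then have "(M, i) \<in> ?S"
      using N(2) no_left_crossing_insert_arc_iff[of "2 * n" M i]
      by (simp add: no_left_crossing_matchings_def)
    then show "N \<in> ?ins ` ?S" using *(4) by (auto intro!: image_eqI[of _ _ "(M, i)"])
  qed
qed

lemma finite_no_left_crossing_matchings: "finite (no_left_crossing_matchings n)"
proof (rule finite_subset)
  show "no_left_crossing_matchings n \<subseteq> Pow (Pow {1..2 * n})"
    unfolding no_left_crossing_matchings_def matching_def partition_on_def by blast
qed simp

lemma card_no_left_crossing_matchings: "card (no_left_crossing_matchings n) = fact n"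
proof (induction n)
  case 0
  then show ?case by (simp add: no_left_crossing_matchings_0)
next
  case (Suc n)
  have sites: "card (insertion_sites M) = Suc n" if "M \<in> no_left_crossing_matchings n" for M
    using that by (simp add: no_left_crossing_matchings_def card_insertion_sites)
  then have "finite (insertion_sites M)" if "M \<in> no_left_crossing_matchings n" for M
    using that by (intro card_ge_0_finite) simp
  then have "card (no_left_crossing_matchings (Suc n)) =
      (\<Sum>M\<in>no_left_crossing_matchings n. card (insertion_sites M))"
    by (simp add: bij_betw_same_card[OF bij_betw_insert_arc_no_left_crossing, symmetric]
        finite_no_left_crossing_matchings)
  also have "\<dots> = fact (Suc n)" using sites Suc.IH by simp
  finally show ?case .
qed

lemma inversion_tables_0: "inversion_tables 0 = {[]}"
  by (auto simp: inversion_tables_def)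

lemma bij_betw_append_inversion_tables:
  "bij_betw (\<lambda>(a, x). a @ [x]) (inversion_tables n \<times> {0..int n}) (inversion_tables (Suc n))"
  unfolding bij_betw_def
proof
  show "inj_on (\<lambda>(a, x). a @ [x]) (inversion_tables n \<times> {0..int n})"
    by (auto simp: inj_on_def)
  have "a @ [x] \<in> inversion_tables (Suc n) \<longleftrightarrow> a \<in> inversion_tables n \<and> x \<in> {0..int n}" for a x
    by (auto simp: inversion_tables_def nth_append atLeastAtMostSuc_conv)
  moreover have "\<exists>a x. b = a @ [x]" if "b \<in> inversion_tables (Suc n)" for b
    using that by (cases b rule: rev_cases) (auto simp: inversion_tables_def)
  ultimately show "(\<lambda>(a, x). a @ [x]) ` (inversion_tables n \<times> {0..int n}) = inversion_tables (Suc n)"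
    by fast
qed

lemma card_inversion_tables: "card (inversion_tables n) = fact n"
proof (induction n)
  case 0
  then show ?case by (simp add: inversion_tables_0)
next
  case (Suc n)
  have "card (inversion_tables (Suc n)) = card (inversion_tables n \<times> {0..int n})"
    by (rule bij_betw_same_card[OF bij_betw_append_inversion_tables, symmetric])
  moreover have "card {0..int n} = Suc n" by simp
  ultimately show ?case using Suc.IH by (simp only: card_cartesian_product fact_Suc) simp
qed

theorem theorem7:
  fixes n :: nat
  shows "(\<exists>f. bij_betw f (no_left_crossing_matchings n) (inversion_tables n)) \<and>
         card (no_left_crossing_matchings n) = fact n"
proof
  have "finite (inversion_tables n)"
    by (rule card_ge_0_finite) (simp add: card_inversion_tables)
  then show "\<exists>f. bij_betw f (no_left_crossing_matchings n) (inversion_tables n)"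
    by (intro finite_same_card_bij)
      (simp_all add: finite_no_left_crossing_matchings card_no_left_crossing_matchings
        card_inversion_tables)
qed (rule card_no_left_crossing_matchings)

end
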